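(* Suppose the Best-Response Algorithm terminates finitely and returns iterates $S_x$ and $S_y$ for the lattice convex-quadratic simultaneous game (LCQS) with $|S_x|>1$ and $|S_y|>1$. Let $Q_1=Q_2=I$ and $\Lambda_1=\Lambda_2=\mathbb{Z}^2$. Given any $\Delta>0$, there exists $C_1$ such that a mixed-strategy Nash equilibrium (MNE) of the finite game restricted to $\operatorname{conv}(S_x)\cap\mathbb{Z}^2$ and $\operatorname{conv}(S_y)\cap\mathbb{Z}^2$ is not a $\Delta$-MNE for the LCQS game.
   Context: The LCQS game: the $x$-player solves $\min_{x\in\Lambda_1}\frac12x^\top Q_1x+(C_1y+d_1)^\top x$ and, simultaneously, the $y$-player solves $\min_{y\in\Lambda_2}\frac12y^\top Q_2y+(C_2x+d_2)^\top y$, where $\Lambda_1\subset\mathbb{R}^{n_x}$, $\Lambda_2\subset\mathbb{R}^{n_y}$ are full-rank lattices and $Q_1,Q_2$ are symmetric positive definite matrices. $I$ is the identity matrix. Best-Response Algorithm: given an initial point $(\hat x^0,\hat y^0)\in\Lambda_1\times\Lambda_2$, for $i=1,2,\dots$ let $\hat x^i$ be a minimizer over $\Lambda_1$ of the $x$-player's objective with $y=\hat y^{i-1}$, and $\hat y^i$ a minimizer over $\Lambda_2$ of the $y$-player's objective with $x=\hat x^{i-1}$ (if there are several minimizers, any one may be chosen); if $(\hat x^i,\hat y^i)=(\hat x^k,\hat y^k)$ for some $k<i$, terminate and return $S_x=\{\hat x^k,\hat x^{k+1},\dots,\hat x^i\}$ and $S_y=\{\hat y^k,\hat y^{k+1},\dots,\hat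 y^i\}$. A mixed strategy is a probability distribution over a finite subset of a player's strategies (feasible points). A mixed-strategy pair $\zeta=(\zeta^x,\zeta^y)$ is a $(\Delta_x,\Delta_y)$-MNE of the game if the $x$-player's expected objective under $\zeta$ is at most $\Delta_x$ plus the $x$-player's expected objective when playing any fixed $x\in\Lambda_1$ against $\zeta^y$, and the $y$-player's expected objective under $\zeta$ is at most $\Delta_y$ plus the $y$-player's expected objective when playing any fixed $y\in\Lambda_2$ against $\zeta^x$. A $\Delta$-MNE is the case $\Delta_x=\Delta_y=\Delta$; an MNE is the case $\Delta_x=\Delta_y=0$. The finite game restricted to given finite strategy sets is the game with the same objectives in which each player may only use (and deviate to) strategies in the given set; $\operatorname{conv}$ denotes convex hull. *)

theory Defs
  imports "HOL-Probability.Probability"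
begin

definition integer_lattice :: "(real ^ 'n) set" where
  "integer_lattice = {z. \<forall>i. z $ i \<in> \<int>}"

definition full_rank_lattice :: "(real ^ 'n) set \<Rightarrow> bool" where
  "full_rank_lattice L \<longleftrightarrow>
     (\<exists>B :: real ^ 'n ^ 'n. invertible B \<and> L = (\<lambda>z. B *v z) ` integer_lattice)"

definition sym_pos_def :: "real ^ 'n ^ 'n \<Rightarrow> bool" where
  "sym_pos_def Q \<longleftrightarrow> transpose Q = Q \<and> (\<forall>v. v \<noteq> 0 \<longrightarrow> 0 < v \<bullet> (Q *v v))"

text \<open>
  The strategy sets are fields of the game, so that restricting the players to other
  strategy sets is a record update; they are required to be lattices only by the
  predicate \<open>lcqs\<close> below.
\<close>

record ('n, 'm) quad_game =
  Q1 :: "real ^ 'n ^ 'n"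
  C1 :: "real ^ 'm ^ 'n"
  d1 :: "real ^ 'n"
  strats1 :: "(real ^ 'n) set"
  Q2 :: "real ^ 'm ^ 'm"
  C2 :: "real ^ 'n ^ 'm"
  d2 :: "real ^ 'm"
  strats2 :: "(real ^ 'm) set"

definition lcqs :: "('n::finite, 'm::finite) quad_game \<Rightarrow> bool" where
  "lcqs G \<longleftrightarrow> sym_pos_def (Q1 G) \<and> sym_pos_def (Q2 G) \<and>
     full_rank_lattice (strats1 G) \<and> full_rank_lattice (strats2 G)"

definition cost1 :: "('n::finite, 'm::finite) quad_game \<Rightarrow> real ^ 'n \<Rightarrow> real ^ 'm \<Rightarrow> real" where
  "cost1 G x y = 1 / 2 * (x \<bullet> (Q1 G *v x)) + (C1 G *v y + d1 G) \<bullet> x"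

definition cost2 :: "('n::finite, 'm::finite) quad_game \<Rightarrow> real ^ 'n \<Rightarrow> real ^ 'm \<Rightarrow> real" where
  "cost2 G x y = 1 / 2 * (y \<bullet> (Q2 G *v y)) + (C2 G *v x + d2 G) \<bullet> y"

definition restrict_game ::
  "('n, 'm) quad_game \<Rightarrow> (real ^ 'n) set \<Rightarrow> (real ^ 'm) set \<Rightarrow> ('n, 'm) quad_game" where
  "restrict_game G A B = G\<lparr>strats1 := A, strats2 := B\<rparr>"

text \<open>
  \<open>best_response_returns G x0 y0 Sx Sy\<close>: some run of the algorithm started at \<open>(x0, y0)\<close>
  terminates and returns \<open>Sx\<close>, \<open>Sy\<close>. It is a relation because ties between
  minimizers may be broken arbitrarily. Here \<open>i\<close> is the first index at which an earlier
  iterate recurs, namely the one with index \<open>k\<close>.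
\<close>

definition best_response_returns ::
  "('n::finite, 'm::finite) quad_game \<Rightarrow> real ^ 'n \<Rightarrow> real ^ 'm
     \<Rightarrow> (real ^ 'n) set \<Rightarrow> (real ^ 'm) set \<Rightarrow> bool" where
  "best_response_returns G x0 y0 Sx Sy \<longleftrightarrow>
     x0 \<in> strats1 G \<and> y0 \<in> strats2 G \<and>
     (\<exists>(X :: nat \<Rightarrow> real ^ 'n) (Y :: nat \<Rightarrow> real ^ 'm) (i :: nat) (k :: nat).
        X 0 = x0 \<and> Y 0 = y0 \<and>
        (\<forall>j\<in>{1..i}.
           is_arg_min (\<lambda>x. cost1 G x (Y (j - 1))) (\<lambda>x. x \<in> strats1 G) (X j) \<and>
           is_arg_min (\<lambda>y. cost2 G (X (j - 1)) y) (\<lambda>y. y \<in> strats2 G) (Y j)) \<and>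
        (\<forall>j<i. \<forall>l<j. (X j, Y j) \<noteq> (X l, Y l)) \<and>
        k < i \<and> (X i, Y i) = (X k, Y k) \<and>
        Sx = X ` {k..i} \<and> Sy = Y ` {k..i})"

definition mixed_strategy :: "'a set \<Rightarrow> 'a pmf \<Rightarrow> bool" where
  "mixed_strategy A p \<longleftrightarrow> finite (set_pmf p) \<and> set_pmf p \<subseteq> A"

definition approx_MNE ::
  "('n::finite, 'm::finite) quad_game \<Rightarrow> real \<Rightarrow> real
     \<Rightarrow> (real ^ 'n) pmf \<Rightarrow> (real ^ 'm) pmf \<Rightarrow> bool" where
  "approx_MNE G \<Delta>x \<Delta>y p q \<longleftrightarrow>
     mixed_strategy (strats1 G) p \<and> mixed_strategy (strats2 G) q \<and>
     (\<forall>x\<in>strats1 G.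
        measure_pmf.expectation (pair_pmf p q) (\<lambda>(x', y'). cost1 G x' y')
          \<le> \<Delta>x + measure_pmf.expectation q (\<lambda>y'. cost1 G x y')) \<and>
     (\<forall>y\<in>strats2 G.
        measure_pmf.expectation (pair_pmf p q) (\<lambda>(x', y'). cost2 G x' y')
          \<le> \<Delta>y + measure_pmf.expectation p (\<lambda>x'. cost2 G x' y))"

abbreviation MNE ::
  "('n::finite, 'm::finite) quad_game \<Rightarrow> (real ^ 'n) pmf \<Rightarrow> (real ^ 'm) pmf \<Rightarrow> bool" where
  "MNE G p q \<equiv> approx_MNE G 0 0 p q"

end

(* In the example the x-player copies the first coordinate s of the other player's strategy, by
   answering (s, 2m s), and the y-player answers 1 - s with s the first coordinate of x. Best
   responses run through a cycle of length 4 between the two points 0 and (1, 2m) resp. 0 and (1, 0).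
   No further lattice point lies on the segments, so the restricted game is a matching-pennies
   game, in which the y-player must mix evenly. Against this mixture the point (0, m), close to
   the middle of the long segment, improves the expected cost of the x-player by m^2/2. *)

theory Submission
  imports Defs
begin

section \<open>Plane vectors, lattice points and two-point mixtures\<close>

lemma vec_eq_2_iff: "x = y \<longleftrightarrow> x $ 1 = y $ 1 \<and> x $ 2 = y $ 2" for x y :: "'a ^ 2"
  by (simp add: vec_eq_iff forall_2)

lemma inner_2: "x \<bullet> y = x $ 1 * y $ 1 + x $ 2 * y $ 2" for x y :: "real ^ 2"
  by (simp add: inner_vec_def sum_2)

lemma full_rank_integer_lattice: "full_rank_lattice integer_lattice"
  unfolding full_rank_lattice_def
  by (intro exI[of _ "mat 1"]) (auto simp: invertible_def intro: exI[of _ "mat 1"])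

lemma sym_pos_def_mat_1: "sym_pos_def (mat 1)"
  by (simp add: sym_pos_def_def)

lemma expectation_pmf_two_point:
  fixes f :: "'a \<Rightarrow> real"
  assumes "set_pmf p \<subseteq> {a, b}" "a \<noteq> b"
  shows "measure_pmf.expectation p f = (1 - pmf p b) * f a + pmf p b * f b"
proof -
  have "pmf p a + pmf p b = 1"
    using sum_pmf_eq_1[of "{a, b}" p] assms by simp
  then have "pmf p a = 1 - pmf p b"
    by linarith
  then show ?thesis
    using assms by (subst integral_measure_pmf[of "{a, b}"]) auto
qed

lemma expectation_pair_pmf_two_point:
  fixes f :: "'a \<Rightarrow> 'b \<Rightarrow> real"
  assumes "set_pmf p \<subseteq> {a, b}" "a \<noteq> b" "set_pmf q \<subseteq> {c, d}" "c \<noteq> d"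
  shows "measure_pmf.expectation (pair_pmf p q) (\<lambda>(x, y). f x y) =
    (1 - pmf p b) * ((1 - pmf q d) * f a c + pmf q d * f a d) +
    pmf p b * ((1 - pmf q d) * f b c + pmf q d * f b d)"
proof -
  have "finite (set_pmf p)" "finite (set_pmf q)"
    using assms by (auto intro: finite_subset)
  then have "measure_pmf.expectation (pair_pmf p q) (\<lambda>(x, y). f x y) =
    measure_pmf.expectation p (\<lambda>x. measure_pmf.expectation q (f x))"
    unfolding pair_pmf_def map_pmf_def[symmetric]
    by (subst pmf_expectation_bind[OF _ _ subset_refl])
       (simp_all add: integral_measure_pmf[of "set_pmf p"])
  then show ?thesis
    by (simp only: expectation_pmf_two_point[OF assms(1,2)] expectation_pmf_two_point[OF assms(3,4)])
qed

text \<open>The first coordinate of a point of the segment is its parameter \<open>u\<close>, so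
  integrality leaves only the two ends, however long the segment is.\<close>

lemma integer_lattice_segment:
  fixes c :: real
  assumes "c \<in> \<int>"
  shows "convex hull {0, vector [1, c]} \<inter> integer_lattice = {0, vector [1, c] :: real ^ 2}"
proof (intro equalityI subsetI)
  fix z :: "real ^ 2"
  assume "z \<in> convex hull {0, vector [1, c]} \<inter> integer_lattice"
  then obtain u where u: "z = u *\<^sub>R vector [1, c]" "0 \<le> u" "u \<le> 1"
    by (auto simp: segment_convex_hull[symmetric] closed_segment_def)
  moreover have "z $ 1 \<in> \<int>"
    using \<open>z \<in> convex hull {0, vector [1, c]} \<inter> integer_lattice\<close> by (simp add: integer_lattice_def)
  ultimately obtain n :: int where "u = of_int n"
    by (auto elim!: Ints_cases)
  with u(2,3) have "u = 0 \<or> u = 1"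
    by auto
  with u(1) show "z \<in> {0, vector [1, c]}"
    by auto
next
  fix z :: "real ^ 2"
  assume "z \<in> {0, vector [1, c]}"
  with assms show "z \<in> convex hull {0, vector [1, c]} \<inter> integer_lattice"
    by (auto simp: integer_lattice_def forall_2 intro: hull_inc)
qed

section \<open>The family of games and its best-response cycle\<close>

text \<open>Only \<open>C1\<close> depends on \<open>m\<close>; all other data stay fixed while the
  gain of the x-player grows with \<open>m\<close>. The zero second columns let each player react to
  the first coordinate of the opponent only.\<close>

definition pennies_game :: "nat \<Rightarrow> (2, 2) quad_game" where
  "pennies_game m =
     \<lparr>Q1 = mat 1, C1 = vector [vector [-1, 0], vector [- 2 * real m, 0]], d1 = 0,
      strats1 = integer_lattice,
      Q2 = mat 1, C2 = vector [vector [1, 0], vector [0, 0]], d2 = vector [-1, 0],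
      strats2 = integer_lattice\<rparr>"

lemma pennies_game_strats [simp]:
  "strats1 (pennies_game m) = integer_lattice" "strats2 (pennies_game m) = integer_lattice"
  by (simp_all add: pennies_game_def)

lemma lcqs_pennies_game: "lcqs (pennies_game m)"
  by (simp add: lcqs_def pennies_game_def full_rank_integer_lattice sym_pos_def_mat_1)

lemma cost1_pennies_game:
  "cost1 (pennies_game m) x y =
     ((x $ 1)\<^sup>2 + (x $ 2)\<^sup>2) / 2 - y $ 1 * (x $ 1 + 2 * real m * x $ 2)"
  by (simp add: cost1_def pennies_game_def)
     (simp add: inner_2 matrix_vector_mult_def sum_2 power2_eq_square algebra_simps)

lemma cost2_pennies_game:
  "cost2 (pennies_game m) x y = ((y $ 1)\<^sup>2 + (y $ 2)\<^sup>2) / 2 + (x $ 1 - 1) * y $ 1"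
  by (simp add: cost2_def pennies_game_def)
     (simp add: inner_2 matrix_vector_mult_def sum_2 power2_eq_square algebra_simps)

text \<open>Completing the square shows that the minimizer over the whole plane is already integral,
  hence it also minimizes over the lattice.\<close>

lemma best_response1_pennies_game:
  assumes "y \<in> integer_lattice"
  shows "is_arg_min (\<lambda>x. cost1 (pennies_game m) x y) (\<lambda>x. x \<in> integer_lattice)
    (vector [y $ 1, 2 * real m * y $ 1])"
proof -
  have "cost1 (pennies_game m) x y =
    ((x $ 1 - y $ 1)\<^sup>2 + (x $ 2 - 2 * real m * y $ 1)\<^sup>2) / 2 - (1 + 4 * (real m)\<^sup>2) * (y $ 1)\<^sup>2 / 2" for x
    by (simp add: cost1_pennies_game power2_eq_square field_simps)
  with assms show ?thesis
    by (auto simp: is_arg_min_linorder integer_lattice_def forall_2)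
qed

lemma best_response2_pennies_game:
  assumes "x \<in> integer_lattice"
  shows "is_arg_min (\<lambda>y. cost2 (pennies_game m) x y) (\<lambda>y. y \<in> integer_lattice)
    (vector [1 - x $ 1, 0])"
proof -
  have "cost2 (pennies_game m) x y =
    ((y $ 1 - (1 - x $ 1))\<^sup>2 + (y $ 2)\<^sup>2) / 2 - (1 - x $ 1)\<^sup>2 / 2" for y
    by (simp add: cost2_pennies_game power2_eq_square field_simps)
  with assms show ?thesis
    by (auto simp: is_arg_min_linorder integer_lattice_def forall_2)
qed

lemma best_response_returns_pennies_game:
  "best_response_returns (pennies_game m) 0 0 {0, vector [1, 2 * real m]} {0, vector [1, 0]}"
proof -
  define b :: "real ^ 2" where "b = vector [1, 2 * real m]"
  define d :: "real ^ 2" where "d = vector [1, 0]"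
  \<comment> \<open>The run is (0, 0), (0, d), (b, d), (b, 0), (0, 0), so the first recurrence is
    index 4 with \<open>k\<close> = 0. Values beyond index 4 are defaults.\<close>
  define X where "X = (\<lambda>n::nat. if n = 2 \<or> n = 3 then b else 0)"
  define Y where "Y = (\<lambda>n::nat. if n = 1 \<or> n = 2 then d else 0)"
  have nz: "b \<noteq> 0" "d \<noteq> 0"
    by (simp_all add: b_def d_def vec_eq_2_iff)
  have lat: "X j \<in> integer_lattice" "Y j \<in> integer_lattice" for j
    by (auto simp: X_def Y_def b_def d_def integer_lattice_def forall_2)
  have j_cases: "j \<in> {1, 2, 3, 4}" if "j \<in> {1..4}" for j :: nat
    using that by auto
  have X_step: "X j = vector [Y (j - 1) $ 1, 2 * real m * Y (j - 1) $ 1]"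
    and Y_step: "Y j = vector [1 - X (j - 1) $ 1, 0]" if "j \<in> {1..4}" for j
    using j_cases[OF that] by (auto simp: X_def Y_def b_def d_def vec_eq_2_iff)
  have distinct: "\<forall>j<4. \<forall>l<j. (X j, Y j) \<noteq> (X l, Y l)"
    using nz by (auto simp: X_def Y_def numeral_eq_Suc less_Suc_eq)
  have "{0..4} = {0, 1, 2, 3, 4 :: nat}"
    by auto
  then have "X ` {0..4} = {0, b}" "Y ` {0..4} = {0, d}"
    by (auto simp: X_def Y_def)
  moreover have "X 0 = 0" "Y 0 = 0" "(X 4, Y 4) = (X 0, Y 0)"
    by (simp_all add: X_def Y_def)
  moreover have "is_arg_min (\<lambda>x. cost1 (pennies_game m) x (Y (j - 1))) (\<lambda>x. x \<in> integer_lattice) (X j)"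
    and "is_arg_min (\<lambda>y. cost2 (pennies_game m) (X (j - 1)) y) (\<lambda>y. y \<in> integer_lattice) (Y j)"
    if "j \<in> {1..4}" for j
    using best_response1_pennies_game[OF lat(2)] best_response2_pennies_game[OF lat(1)]
    by (simp_all only: X_step[OF that] Y_step[OF that])
  moreover have "(0 :: real ^ 2) \<in> integer_lattice"
    by (simp add: integer_lattice_def)
  ultimately show ?thesis
    unfolding best_response_returns_def b_def[symmetric] d_def[symmetric] pennies_game_strats
    using distinct by (intro conjI exI[of _ X] exI[of _ Y] exI[of _ 4] exI[of _ 0]) auto
qed

section \<open>Equilibria of the restricted game\<close>

abbreviation restricted_pennies_game :: "nat \<Rightarrow> (2, 2) quad_game" where
  "restricted_pennies_game m \<equiv>
     restrict_game (pennies_game m) {0, vector [1, 2 * real m]} {0, vector [1, 0]}"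

lemma cost_restrict_game [simp]:
  "cost1 (restrict_game G A B) = cost1 G" "cost2 (restrict_game G A B) = cost2 G"
  by (simp_all add: restrict_game_def cost1_def cost2_def fun_eq_iff)

text \<open>Each mixture is described by one weight, so being an equilibrium is a condition on
  \<open>s\<close> and \<open>t\<close>. The last claim holds for every \<open>x\<close> of the
  plane, so that it also prices deviations that leave the restricted game.\<close>

lemma MNE_restricted_pennies_game:
  fixes m :: nat and p q :: "(real ^ 2) pmf"
  defines "s \<equiv> pmf p (vector [1, 2 * real m])" and "t \<equiv> pmf q (vector [1, 0])"
  assumes p: "set_pmf p \<subseteq> {0, vector [1, 2 * real m]}" and q: "set_pmf q \<subseteq> {0, vector [1, 0]}"
  shows "MNE (restricted_pennies_game m) p q \<longleftrightarrow> s = 1 / 2 \<and> t = 1 / 2" (is "?L \<longleftrightarrow> ?R")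
    and "measure_pmf.expectation (pair_pmf p q) (\<lambda>(x, y). cost1 (pennies_game m) x y) =
      (1 + 4 * (real m)\<^sup>2) * (s * (1 / 2 - t))"
    and "measure_pmf.expectation q (\<lambda>y. cost1 (pennies_game m) x y) =
      ((x $ 1)\<^sup>2 + (x $ 2)\<^sup>2) / 2 - t * (x $ 1 + 2 * real m * x $ 2)"
proof -
  have nz: "0 \<noteq> (vector [1, c] :: real ^ 2)" for c :: real
    by (simp add: vec_eq_2_iff)
  note pair = expectation_pair_pmf_two_point[OF p nz q nz, folded s_def t_def]
  have pair1: "measure_pmf.expectation (pair_pmf p q) (\<lambda>(x, y). cost1 (pennies_game m) x y) =
      (1 + 4 * (real m)\<^sup>2) * (s * (1 / 2 - t))"
    unfolding pair by (simp add: cost1_pennies_game power2_eq_square field_simps)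
  have pair2: "measure_pmf.expectation (pair_pmf p q) (\<lambda>(x, y). cost2 (pennies_game m) x y) =
      t * (s - 1 / 2)"
    unfolding pair by (simp add: cost2_pennies_game power2_eq_square field_simps)
  have dev1: "measure_pmf.expectation q (\<lambda>y. cost1 (pennies_game m) x y) =
      ((x $ 1)\<^sup>2 + (x $ 2)\<^sup>2) / 2 - t * (x $ 1 + 2 * real m * x $ 2)" for x
    unfolding expectation_pmf_two_point[OF q nz, folded t_def]
    by (simp add: cost1_pennies_game power2_eq_square field_simps)
  have dev2: "measure_pmf.expectation p (\<lambda>x. cost2 (pennies_game m) x y) =
      ((y $ 1)\<^sup>2 + (y $ 2)\<^sup>2) / 2 + (s - 1) * y $ 1" for y
    unfolding expectation_pmf_two_point[OF p nz, folded s_def]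
    by (simp add: cost2_pennies_game power2_eq_square field_simps)
  have fin: "finite (set_pmf p)" "finite (set_pmf q)"
    using p q by (auto intro: finite_subset)
  \<comment> \<open>\<open>K\<close> is the squared length of the long strategy. It is a common
    positive factor of the x-player's costs, so the equilibrium condition will not depend on
    \<open>m\<close>.\<close>
  define K where "K = 1 + 4 * (real m)\<^sup>2"
  have "K > 0"
    by (simp add: K_def add_pos_nonneg)
  have long: "((1::real)\<^sup>2 + (2 * real m)\<^sup>2) / 2 - t * (1 + 2 * real m * (2 * real m)) = K * (1 / 2 - t)"
    by (simp add: K_def power2_eq_square field_simps)
  \<comment> \<open>The four inequalities are the deviations of the x-player to 0 and to the long
    strategy, then those of the y-player to 0 and to (1, 0).\<close>
  have "?L \<longleftrightarrow> K * (s * (1 / 2 - t)) \<le> 0 \<and> K * (s * (1 / 2 - t)) \<le> K * (1 / 2 - t) \<and>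
      t * (s - 1 / 2) \<le> 0 \<and> t * (s - 1 / 2) \<le> s - 1 / 2"
    using p q fin long
    by (simp add: approx_MNE_def mixed_strategy_def pair1 pair2 dev1 dev2 K_def)
       (simp add: restrict_game_def)
  also have "\<dots> \<longleftrightarrow> s * (1 / 2 - t) \<le> 0 \<and> s * (1 / 2 - t) \<le> 1 / 2 - t \<and>
      t * (s - 1 / 2) \<le> 0 \<and> t * (s - 1 / 2) \<le> s - 1 / 2"
    using \<open>K > 0\<close> by (simp only: mult_le_cancel_left_pos mult_le_0_iff) auto
  also have "\<dots> \<longleftrightarrow> ?R"
  proof
    assume *: "s * (1 / 2 - t) \<le> 0 \<and> s * (1 / 2 - t) \<le> 1 / 2 - t \<and>
      t * (s - 1 / 2) \<le> 0 \<and> t * (s - 1 / 2) \<le> s - 1 / 2"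
    have bounds: "0 \<le> s" "s \<le> 1" "0 \<le> t" "t \<le> 1"
      by (simp_all add: s_def t_def pmf_le_1)
    \<comment> \<open>All four conditions are now signs of products with a nonnegative factor. If t
      < 1/2 then s = 0, which forces t = 1; if t > 1/2 then s = 1, which forces t = 0. At t = 1/2
      the y-player's conditions give s = 1/2.\<close>
    have **: "(1 - s) * (t - 1 / 2) \<le> 0" "(1 - t) * (1 / 2 - s) \<le> 0"
      using * by (simp_all add: field_simps)
    show ?R
      using * ** bounds by (auto simp: mult_le_0_iff)
  next
    assume ?R
    then show "s * (1 / 2 - t) \<le> 0 \<and> s * (1 / 2 - t) \<le> 1 / 2 - t \<and>
      t * (s - 1 / 2) \<le> 0 \<and> t * (s - 1 / 2) \<le> s - 1 / 2"
      by (elim conjE) (simp only:, simp)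
  qed
  finally show "?L \<longleftrightarrow> ?R" .
  show "measure_pmf.expectation (pair_pmf p q) (\<lambda>(x, y). cost1 (pennies_game m) x y) =
      (1 + 4 * (real m)\<^sup>2) * (s * (1 / 2 - t))"
    by (fact pair1)
  show "measure_pmf.expectation q (\<lambda>y. cost1 (pennies_game m) x y) =
      ((x $ 1)\<^sup>2 + (x $ 2)\<^sup>2) / 2 - t * (x $ 1 + 2 * real m * x $ 2)"
    by (fact dev1)
qed

text \<open>The even mixtures are an equilibrium, so the claim about all equilibria is not
  vacuous.\<close>

lemma ex_MNE_restricted_pennies_game: "\<exists>p q. MNE (restricted_pennies_game m) p q"
proof -
  have "(0 :: real ^ 2) \<noteq> vector [1, c]" for c :: real
    by (simp add: vec_eq_2_iff)
  then show ?thesis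
    by (intro exI[of _ "pmf_of_set {0, vector [1, 2 * real m]}"] exI[of _ "pmf_of_set {0, vector [1, 0]}"])
       (simp add: MNE_restricted_pennies_game)
qed

lemma not_approx_MNE_pennies_game:
  assumes "MNE (restricted_pennies_game m) p q" and m: "\<Delta>x < (real m)\<^sup>2 / 2"
  shows "\<not> approx_MNE (pennies_game m) \<Delta>x \<Delta>y p q"
proof
  assume approx: "approx_MNE (pennies_game m) \<Delta>x \<Delta>y p q"
  have p: "set_pmf p \<subseteq> {0, vector [1, 2 * real m]}" and q: "set_pmf q \<subseteq> {0, vector [1, 0]}"
    using assms(1) by (auto simp: approx_MNE_def mixed_strategy_def restrict_game_def)
  note facts = MNE_restricted_pennies_game[OF p q]
  have t: "pmf q (vector [1, 0]) = 1 / 2"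
    using assms(1) facts(1) by blast
  \<comment> \<open>Against the even mixture the x-player's minimizer over the plane is (1/2, m),
    the midpoint of the segment; (0, m) is a closest lattice point.\<close>
  have "(vector [0, real m] :: real ^ 2) \<in> integer_lattice"
    by (simp add: integer_lattice_def forall_2)
  with approx have "measure_pmf.expectation (pair_pmf p q) (\<lambda>(x, y). cost1 (pennies_game m) x y)
      \<le> \<Delta>x + measure_pmf.expectation q (\<lambda>y. cost1 (pennies_game m) (vector [0, real m]) y)"
    by (simp add: approx_MNE_def)
  \<comment> \<open>The equilibrium cost vanishes because \<open>t\<close> = 1/2, and the deviation
    costs m^2/2 - m^2.\<close>
  then have "0 \<le> \<Delta>x - (real m)\<^sup>2 / 2"
    unfolding facts t by (simp add: power2_eq_square)
  with m show False
    by simp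
qed

theorem theorem7:
  "\<exists>(D2 :: real ^ 2 ^ 2) (e1 :: real ^ 2) (e2 :: real ^ 2) (x0 :: real ^ 2) (y0 :: real ^ 2).
     \<forall>\<Delta>::real. \<Delta> > 0 \<longrightarrow>
       (\<exists>(D1 :: real ^ 2 ^ 2) (G :: (2, 2) quad_game) (Sx :: (real ^ 2) set) (Sy :: (real ^ 2) set).
          G = \<lparr>Q1 = mat 1, C1 = D1, d1 = e1, strats1 = integer_lattice,
               Q2 = mat 1, C2 = D2, d2 = e2, strats2 = integer_lattice\<rparr> \<and>
          lcqs G \<and>
          best_response_returns G x0 y0 Sx Sy \<and>
          card Sx > 1 \<and> card Sy > 1 \<and>
          (\<exists>p q. MNE (restrict_game G (convex hull Sx \<inter> integer_lattice)
                                      (convex hull Sy \<inter> integer_lattice)) p q) \<and>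
          (\<forall>p q. MNE (restrict_game G (convex hull Sx \<inter> integer_lattice)
                                      (convex hull Sy \<inter> integer_lattice)) p q
                 \<longrightarrow> \<not> approx_MNE G \<Delta> \<Delta> p q))"
proof -
  \<comment> \<open>The data that must not depend on \<Delta> are written out, so that unification
    with this fact instantiates the outer existentials.\<close>
  have witness: "\<exists>D1 (G :: (2, 2) quad_game) Sx Sy.
      G = \<lparr>Q1 = mat 1, C1 = D1, d1 = 0, strats1 = integer_lattice, Q2 = mat 1,
           C2 = vector [vector [1, 0], vector [0, 0]], d2 = vector [-1, 0],
           strats2 = integer_lattice\<rparr> \<and>
      lcqs G \<and> best_response_returns G 0 0 Sx Sy \<and> card Sx > 1 \<and> card Sy > 1 \<and>
      (\<exists>p q. MNE (restrict_game G (convex hull Sx \<inter> integer_lattice)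
                                  (convex hull Sy \<inter> integer_lattice)) p q) \<and>
      (\<forall>p q. MNE (restrict_game G (convex hull Sx \<inter> integer_lattice)
                                  (convex hull Sy \<inter> integer_lattice)) p q
             \<longrightarrow> \<not> approx_MNE G \<Delta> \<Delta> p q)" for \<Delta> :: real
  proof -
    \<comment> \<open>The bound by 1 gives \<open>real m\<close> \<le> m^2, so that a lower bound on
      \<open>m\<close> becomes one on its square.\<close>
    obtain m :: nat where "max 1 (2 * \<Delta>) < real m"
      using reals_Archimedean2 by blast
    then have "2 * \<Delta> < real m" "real m \<le> (real m)\<^sup>2"
      by (simp_all add: power2_eq_square)
    then have m: "\<Delta> < (real m)\<^sup>2 / 2"
      by linarith
    let ?b = "vector [1, 2 * real m] :: real ^ 2" and ?d = "vector [1, 0] :: real ^ 2"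
    have "0 \<noteq> ?b" "0 \<noteq> ?d"
      by (simp_all add: vec_eq_2_iff)
    then have card: "card {0, ?b} > 1" "card {0, ?d} > 1"
      by simp_all
    have hull: "convex hull {0, ?b} \<inter> integer_lattice = {0, ?b}"
      "convex hull {0, ?d} \<inter> integer_lattice = {0, ?d}"
      by (simp_all add: integer_lattice_segment)
    show ?thesis
    proof (rule exI[of _ "C1 (pennies_game m)"], rule exI[of _ "pennies_game m"],
        rule exI[of _ "{0, ?b}"], rule exI[of _ "{0, ?d}"], unfold hull, intro conjI)
      show "pennies_game m = \<lparr>Q1 = mat 1, C1 = C1 (pennies_game m), d1 = 0,
           strats1 = integer_lattice, Q2 = mat 1,
           C2 = vector [vector [1, 0], vector [0, 0]], d2 = vector [-1, 0],
           strats2 = integer_lattice\<rparr>"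
        by (simp add: pennies_game_def)
    qed (use m card in \<open>simp_all add: lcqs_pennies_game best_response_returns_pennies_game
          ex_MNE_restricted_pennies_game not_approx_MNE_pennies_game\<close>)
  qed
  show ?thesis
    by ((rule exI)+, intro allI impI, rule witness)
qed

end
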